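(* For every cardinal $\tau>\omega_1$, the hyperspace $\mathrm{mpcc}(\mathbb R^\tau)$ is not an absolute retract (i.e. is not homeomorphic to a retract of a functionally open subspace of a power of $\mathbb R$; in particular it is not homeomorphic to $\mathbb R^\tau$).
   Context: For a cardinal $\tau$, $x,y\in\mathbb R^\tau$ and $\lambda\in\mathbb R_{\max}=\mathbb R\cup\{-\infty\}$, $x\oplus y$ denotes the coordinatewise maximum and $\lambda\odot x$ the vector obtained by adding $\lambda$ to every coordinate. A subset $A\subset\mathbb R^\tau$ is max-plus convex if $\alpha\odot a\oplus\beta\odot b\in A$ for all $a,b\in A$ and $\alpha,\beta\in\mathbb R_{\max}$ with $\max(\alpha,\beta)=0$. $\mathrm{mpcc}(\mathbb R^\tau)$ is the set of nonempty compact max-plus convex subsets of $\mathbb R^\tau$ (Tychonov product topology) with the Vietoris topology. Absolute retracts here are meant in the sense of the theory of nonmetrizable absolute extensors (Chigogidze): for Tychonov spaces of weight $\tau$, these are retracts of functionally open subspaces of powers of the real line; a set $U\subset X$ is functionally open if $U=f^{-1}((0,1])$ for a continuous $f\colon X\to[0,1]$. *)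

theory Defs
  imports "HOL-Analysis.Analysis"
begin

text \<open>Max-plus convexity. Coefficients alpha, beta range over R_max = R with -infinity;
  if one of them is -infinity the other is 0 and the combination is just a or b,
  which lies in A trivially, so only real coefficients need to be listed.\<close>
definition maxplus_convex :: "('a \<Rightarrow> real) set \<Rightarrow> bool" where
  "maxplus_convex A \<longleftrightarrow>
     (\<forall>a\<in>A. \<forall>b\<in>A. \<forall>\<alpha> \<beta> :: real. max \<alpha> \<beta> = 0 \<longrightarrow>
        (\<lambda>i. max (\<alpha> + a i) (\<beta> + b i)) \<in> A)"

definition mpcc :: "('a \<Rightarrow> real) set set" where
  "mpcc = {K. K \<noteq> {} \<and> compactin (powertop_real UNIV) K \<and> maxplus_convex K}"

definition vietoris_on :: "'x topology \<Rightarrow> 'x set set \<Rightarrow> 'x set topology" where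
  "vietoris_on X C = topology_generated_by
     ({{K \<in> C. K \<subseteq> U} | U. openin X U} \<union> {{K \<in> C. K \<inter> U \<noteq> {}} | U. openin X U})"

definition mpcc_space :: "('a \<Rightarrow> real) set topology" where
  "mpcc_space = vietoris_on (powertop_real UNIV) mpcc"

definition functionally_open :: "'x topology \<Rightarrow> 'x set \<Rightarrow> bool" where
  "functionally_open X U \<longleftrightarrow>
     (\<exists>f. continuous_map X (top_of_set {0..1::real}) f \<and> U = {x \<in> topspace X. f x \<in> {0<..1}})"

definition retract_of_fopen_sub :: "'y topology \<Rightarrow> 'x topology \<Rightarrow> bool" where
  "retract_of_fopen_sub P T \<longleftrightarrow>
     (\<exists>U Y. functionally_open P U \<and> Y retract_of_space (subtopology P U) \<and>
            T homeomorphic_space subtopology P Y)"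

end

theory Submission
  imports Defs "HOL-Library.Countable_Set_Type"
begin

text \<open>Suppose \<open>h\<close> embeds the hyperspace onto a retract, via \<open>r\<close>, of a cozero set \<open>U\<close> of a power of the
  line. Continuous real functions on \<open>U\<close>, and on the power of the line over \<open>'a \<times> bool\<close>, depend on
  countably many coordinates. Fix a coordinate \<open>x\<close>. Because there are more than \<open>\<omega>\<^sub>1\<close> coordinates,
  there are \<open>a\<close>, \<open>b\<close> such that no coordinate of \<open>h\<close> that matters both for the \<open>(x, a)\<close>-projection and
  for the \<open>(x, b)\<close>-projection can see \<open>a\<close> or \<open>b\<close>. The max-plus segments \<open>K1\<close> from \<open>0\<close> to
  \<open>\<epsilon> e\<^sub>x + e\<^sub>a + e\<^sub>b\<close> and \<open>K2\<close> from \<open>e\<^sub>a + e\<^sub>b\<close> to \<open>\<epsilon> e\<^sub>x\<close> then have the same images in these common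
  coordinates, so \<open>h K1\<close> and \<open>h K2\<close> can be glued to a point of the power that is close to \<open>h K0\<close>,
  where \<open>K0\<close> is the segment from \<open>0\<close> to \<open>e\<^sub>a + e\<^sub>b\<close>. Retracting it yields a set \<open>K'\<close> near \<open>K0\<close> with
  the \<open>(x, a)\<close>-projection of \<open>K1\<close> and the \<open>(x, b)\<close>-projection of \<open>K2\<close>. The former gives a point of \<open>K'\<close>
  with \<open>x\<close>- and \<open>a\<close>-coordinate \<open>0\<close>, the latter forces its \<open>b\<close>-coordinate to be \<open>1\<close>; but the \<open>a\<close>- and
  \<open>b\<close>-coordinates agree on \<open>K0\<close>.\<close>

section \<open>Free pairs for set mappings with countable values\<close>

text \<open>Choose \<open>S\<close> of cardinality aleph_1. The sets \<open>A s\<close> with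
  \<open>s\<close> in \<open>S\<close> cover at most aleph_1 points, so some \<open>a\<close> lies
  in none of them; and the uncountable \<open>S\<close> cannot be contained in the countable
  \<open>A a\<close>.\<close>

lemma free_pair_countable_set_mapping:
  fixes A :: "'a \<Rightarrow> 'a set"
  assumes card: "(cardSuc natLeq, card_of (UNIV :: 'a set)) \<in> ordLess"
    and count: "\<And>a. countable (A a)"
  obtains a b where "b \<notin> A a" "a \<notin> A b"
proof -
  let ?c = "cardSuc natLeq"
  have co: "Card_order ?c"
    by (simp add: cardSuc_Card_order natLeq_Card_order)
  have fld: "(card_of (Field ?c), ?c) \<in> ordIso"
    by (rule card_of_Field_ordIso[OF co])
  then have "(card_of (Field ?c), card_of (UNIV :: 'a set)) \<in> ordLeq"
    using card by (meson ordIso_ordLess_trans ordLess_imp_ordLeq)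
  then obtain S :: "'a set" where "(card_of (Field ?c), card_of S) \<in> ordIso"
    unfolding internalize_card_of_ordLeq2[of "Field ?c"] by auto
  then have S: "(card_of S, ?c) \<in> ordIso"
    by (rule ordIso_transitive[OF ordIso_symmetric fld])
  have gt: "(natLeq, ?c) \<in> ordLess"
    by (simp add: cardSuc_greater natLeq_Card_order)
  then have natS: "(natLeq, card_of S) \<in> ordLess"
    by (rule ordLess_ordIso_trans[OF _ ordIso_symmetric[OF S]])
  then have uncS: "\<not> countable S"
    by (simp add: countable_card_le_natLeq not_ordLeq_iff_ordLess card_of_Well_order natLeq_Well_order)
  have "(card_of (\<Union>s\<in>S. A s), card_of S) \<in> ordLeq"
  proof (rule card_of_UNION_ordLeq_infinite)
    show "infinite S"
      using uncS countable_finite by blast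
    show "\<forall>s\<in>S. (card_of (A s), card_of S) \<in> ordLeq"
      using count natS by (meson countable_card_le_natLeq ordLeq_ordLess_trans ordLess_imp_ordLeq)
  qed (rule card_of_refl[THEN ordIso_imp_ordLeq])
  then have "(card_of (\<Union>s\<in>S. A s), card_of (UNIV :: 'a set)) \<in> ordLess"
    using S card by (meson ordLeq_ordIso_trans ordLeq_ordLess_trans)
  then have "(\<Union>s\<in>S. A s) \<noteq> UNIV"
    using ordLess_irreflexive by fastforce
  then obtain a where a: "a \<notin> (\<Union>s\<in>S. A s)"
    by blast
  have "\<not> S \<subseteq> A a"
    using uncS count countable_subset by blast
  then obtain b where "b \<in> S" "b \<notin> A a"
    by blast
  with a that show thesis
    by blast
qed


section \<open>Continuous functions depend on countably many coordinates\<close>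

lemma compact_box_fun:
  "compact {u :: 'b \<Rightarrow> real. \<forall>i. u i \<in> {a..b}}"
proof -
  have "compactin (powertop_real UNIV) (PiE (UNIV :: 'b set) (\<lambda>_. {a..b}))"
    by (simp add: compactin_PiE)
  then show ?thesis
    by (simp add: euclidean_product_topology PiE_UNIV_domain Pi_def)
qed

text \<open>Each point of \<open>C\<close> has a basic box on which \<open>F\<close> varies by less
  than \<delta>, and changing coordinates that the box leaves unrestricted stays inside it. Finitely
  many boxes cover \<open>C\<close>; only \<open>u\<close> must lie in \<open>C\<close>, not
  \<open>v\<close>.\<close>

lemma continuous_on_compact_finite_coordinates:
  fixes F :: "('b \<Rightarrow> real) \<Rightarrow> real"
  assumes F: "continuous_on U F" and U: "open U" and C: "compact C" "C \<subseteq> U" and "\<delta> > 0"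
  shows "\<exists>J. finite J \<and> (\<forall>u\<in>C. \<forall>v. (\<forall>j\<in>J. u j = v j) \<longrightarrow> \<bar>F u - F v\<bar> < \<delta>)"
proof -
  have "\<exists>N J. open N \<and> p \<in> N \<and> finite J \<and> (\<forall>u\<in>N. \<forall>v. (\<forall>j\<in>J. u j = v j) \<longrightarrow> \<bar>F u - F v\<bar> < \<delta>)"
    if "p \<in> C" for p
  proof -
    define V where "V = U \<inter> F -` ball (F p) (\<delta>/2)"
    have "open V"
      unfolding V_def by (rule continuous_open_preimage[OF F U open_ball])
    moreover have "p \<in> V"
      using that C \<open>\<delta> > 0\<close> by (auto simp: V_def)
    ultimately obtain X where X: "p \<in> PiE UNIV X" "\<forall>i. open (X i)" "finite {i. X i \<noteq> UNIV}" "PiE UNIV X \<subseteq> V"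
      using product_topology_open_contains_basis[of "\<lambda>_. euclidean" UNIV V p]
      by (auto simp: euclidean_product_topology)
    have "\<bar>F u - F v\<bar> < \<delta>"
      if u: "u \<in> PiE UNIV X" and uv: "\<forall>j\<in>{i. X i \<noteq> UNIV}. u j = v j" for u v
    proof -
      have "v \<in> PiE UNIV X"
        unfolding PiE_UNIV_domain Pi_iff
      proof
        fix i
        show "v i \<in> X i"
          using u uv by (cases "X i = UNIV") (simp, metis (mono_tags) PiE_UNIV_domain Pi_iff UNIV_I mem_Collect_eq)
      qed
      then have "dist (F p) (F u) < \<delta>/2" "dist (F p) (F v) < \<delta>/2"
        using u X by (auto simp: V_def)
      then show ?thesis
        unfolding dist_real_def by linarith
    qed
    moreover have "open (PiE UNIV X)"
      using X by (intro open_PiE) auto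
    ultimately show ?thesis
      using X(1,3) by (intro exI[of _ "PiE UNIV X"] exI[of _ "{i. X i \<noteq> UNIV}"] conjI ballI allI impI) auto
  qed
  then obtain N J where NJ: "\<And>p. p \<in> C \<Longrightarrow> open (N p) \<and> p \<in> N p \<and> finite (J p) \<and>
      (\<forall>u\<in>N p. \<forall>v. (\<forall>j\<in>J p. u j = v j) \<longrightarrow> \<bar>F u - F v\<bar> < \<delta>)"
    by metis
  obtain D where D: "D \<subseteq> C" "finite D" "C \<subseteq> (\<Union>p\<in>D. N p)"
    by (rule compactE_image[OF C(1), of C N]) (use NJ in auto)
  show ?thesis
  proof (intro exI conjI ballI allI impI)
    show "finite (\<Union>p\<in>D. J p)"
      using D NJ by auto
    fix u v
    assume "u \<in> C" and uv: "\<forall>j\<in>\<Union>p\<in>D. J p. u j = v j"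
    then obtain p where "p \<in> D" "u \<in> N p"
      using D by auto
    moreover have "p \<in> C"
      using \<open>p \<in> D\<close> D by auto
    ultimately show "\<bar>F u - F v\<bar> < \<delta>"
      using NJ[of p] uv by blast
  qed
qed

definition determined_by :: "'b set \<Rightarrow> ('b \<Rightarrow> real) set \<Rightarrow> (('b \<Rightarrow> real) \<Rightarrow> 'c) \<Rightarrow> bool" where
  "determined_by B U F \<longleftrightarrow> (\<forall>u\<in>U. \<forall>v\<in>U. (\<forall>j\<in>B. u j = v j) \<longrightarrow> F u = F v)"

lemma tendsto_clamp_fun:
  fixes u :: "'b \<Rightarrow> real"
  shows "(\<lambda>m i. max (- real m) (min (real m) (u i))) \<longlonglongrightarrow> u"
proof -
  have "(\<lambda>m. max (- real m) (min (real m) (u i))) \<longlonglongrightarrow> u i" for i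
  proof (rule tendsto_eventually, rule eventually_sequentiallyI)
    fix m :: nat assume "nat \<lceil>\<bar>u i\<bar>\<rceil> \<le> m"
    then have "\<bar>u i\<bar> \<le> real m"
      by linarith
    then show "max (- real m) (min (real m) (u i)) = u i"
      by auto
  qed
  then have "limitin (product_topology (\<lambda>_. euclidean) UNIV)
      (\<lambda>m i. max (- real m) (min (real m) (u i))) u sequentially"
    by (simp add: limitin_componentwise)
  then show ?thesis
    by (simp add: euclidean_product_topology)
qed

text \<open>Truncating the coordinates at height \<open>m\<close> moves a point of the cozero set \<open>U\<close> into a compact
  subset of \<open>U\<close>, where only finitely many coordinates matter up to a given error.\<close>

lemma cozero_countably_determined:
  fixes f F :: "('b \<Rightarrow> real) \<Rightarrow> real"
  assumes f: "continuous_on UNIV f" and F: "continuous_on {u. f u > 0} F"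
  shows "\<exists>B. countable B \<and> determined_by B {u. f u > 0} F"
proof -
  define U where "U = {u. f u > 0}"
  \<comment> \<open>Bounding \<open>f\<close> below by a positive number, instead of just asking
    \<open>f u > 0\<close>, keeps \<open>C m\<close> closed and hence compact.\<close>
  define C where "C m = {u. (\<forall>i. u i \<in> {- real m..real m})} \<inter> {u. inverse (real (Suc m)) \<le> f u}" for m
  have U: "open U"
    unfolding U_def by (intro open_Collect_less f continuous_on_const)
  have compC: "compact (C m)" for m
    unfolding C_def by (intro compact_Int_closed compact_box_fun closed_Collect_le f continuous_on_const)
  have CU: "C m \<subseteq> U" for m
    unfolding C_def U_def by (auto intro: less_le_trans[rotated])
  have "\<exists>J. finite J \<and> (\<forall>u\<in>C m. \<forall>v. (\<forall>j\<in>J. u j = v j) \<longrightarrow> \<bar>F u - F v\<bar> < inverse (real (Suc m)))" for m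
    by (rule continuous_on_compact_finite_coordinates[OF _ U compC CU]) (use F in \<open>auto simp: U_def\<close>)
  then obtain J where J: "\<And>m. finite (J m)"
    "\<And>m u v. u \<in> C m \<Longrightarrow> \<forall>j\<in>J m. u j = v j \<Longrightarrow> \<bar>F u - F v\<bar> < inverse (real (Suc m))"
    by metis
  have "F u = F v" if u: "u \<in> U" and v: "v \<in> U" and uv: "\<forall>j\<in>\<Union>m. J m. u j = v j" for u v
  proof -
    define c where "c w m = (\<lambda>i. max (- real m) (min (real m) (w i)))" for w :: "'b \<Rightarrow> real" and m
    have c: "c w \<longlonglongrightarrow> w" for w
      using tendsto_clamp_fun[of w] by (simp add: c_def[abs_def])
    have Fc: "(\<lambda>m. F (c w m)) \<longlonglongrightarrow> F w" if "w \<in> U" for w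
      by (rule continuous_on_tendsto_compose[OF F c])
        (use that topological_tendstoD[OF c U that] in \<open>auto simp: U_def\<close>)
    have "(\<lambda>m. f (c u m) - inverse (real (Suc m))) \<longlonglongrightarrow> f u - 0"
      by (intro tendsto_diff LIMSEQ_inverse_real_of_nat continuous_on_tendsto_compose[OF f c]) auto
    then have "\<forall>\<^sub>F m in sequentially. 0 < f (c u m) - inverse (real (Suc m))"
      using u by (intro order_tendstoD(1)) (auto simp: U_def)
    \<comment> \<open>Only the truncation of \<open>u\<close> has to lie in \<open>C m\<close>; that
      of \<open>v\<close> merely agrees with it on \<open>J m\<close>.\<close>
    then have "\<forall>\<^sub>F m in sequentially. norm (F (c u m) - F (c v m)) \<le> inverse (real (Suc m))"
    proof eventually_elim
      case (elim m)
      then have "c u m \<in> C m"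
        by (auto simp: C_def c_def)
      then show ?case
        using J(2)[of "c u m" m "c v m"] uv by (simp add: c_def)
    qed
    then have "(\<lambda>m. F (c u m) - F (c v m)) \<longlonglongrightarrow> 0"
      using LIMSEQ_inverse_real_of_nat by (rule Lim_null_comparison)
    moreover have "(\<lambda>m. F (c u m) - F (c v m)) \<longlonglongrightarrow> F u - F v"
      by (intro tendsto_diff Fc u v)
    ultimately show ?thesis
      using LIMSEQ_unique by fastforce
  qed
  then have "determined_by (\<Union>m. J m) {u. f u > 0} F"
    unfolding determined_by_def U_def by blast
  moreover have "countable (\<Union>m. J m)"
    by (intro countable_UN[OF countableI_type] countable_finite J(1))
  ultimately show ?thesis
    by blast
qed


section \<open>The Vietoris topology on max-plus convex compacta\<close>

lemma mpcc_iff: "K \<in> mpcc \<longleftrightarrow> K \<noteq> {} \<and> compact K \<and> maxplus_convex K"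
  by (simp add: mpcc_def euclidean_product_topology)

lemma topspace_mpcc_space [simp]: "topspace (mpcc_space :: ('a \<Rightarrow> real) set topology) = mpcc"
proof -
  have "mpcc \<in> {{K \<in> mpcc. K \<subseteq> U} |U. openin (powertop_real (UNIV :: 'a set)) U}"
    by (auto simp: euclidean_product_topology intro!: exI[of _ UNIV])
  then have "mpcc \<subseteq> topspace (mpcc_space :: ('a \<Rightarrow> real) set topology)"
    unfolding mpcc_space_def vietoris_on_def topology_generated_by_topspace by (intro Union_upper UnI1)
  moreover have "topspace (mpcc_space :: ('a \<Rightarrow> real) set topology) \<subseteq> mpcc"
    unfolding mpcc_space_def vietoris_on_def topology_generated_by_topspace by auto
  ultimately show ?thesis
    by (rule equalityI[rotated])
qed

lemma openin_mpcc_space_subset: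
  "open W \<Longrightarrow> openin mpcc_space {K \<in> mpcc. K \<subseteq> W}"
  unfolding mpcc_space_def vietoris_on_def
  by (rule topology_generated_by_Basis) (auto simp: euclidean_product_topology)

lemma openin_mpcc_space_meets:
  "open W \<Longrightarrow> openin mpcc_space {K \<in> mpcc. K \<inter> W \<noteq> {}}"
  unfolding mpcc_space_def vietoris_on_def
  by (rule topology_generated_by_Basis) (auto simp: euclidean_product_topology)

lemma Sup_image_compact_attained:
  fixes g :: "'x::topological_space \<Rightarrow> real"
  assumes "continuous_on UNIV g" "compact K" "K \<noteq> {}"
  obtains v where "v \<in> K" "Sup (g ` K) = g v" "\<And>w. w \<in> K \<Longrightarrow> g w \<le> g v"
proof -
  obtain v where v: "v \<in> K" "\<And>w. w \<in> K \<Longrightarrow> g w \<le> g v"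
    using continuous_attains_sup[of K g] assms continuous_on_subset by (metis top_greatest)
  moreover have "Sup (g ` K) = g v"
    using v by (intro cSup_eq_maximum) auto
  ultimately show thesis
    using that by blast
qed

text \<open>The supremum exceeds \<open>c\<close> iff \<open>K\<close> meets an open set and, being
  attained, is below \<open>c\<close> iff \<open>K\<close> lies in an open set: the two kinds of
  subbasic Vietoris sets. Such suprema are the real functions to which countable determination is
  later applied.\<close>

lemma continuous_map_Sup_mpcc_space:
  fixes g :: "('a \<Rightarrow> real) \<Rightarrow> real"
  assumes g: "continuous_on UNIV g"
  shows "continuous_map mpcc_space euclideanreal (\<lambda>K. Sup (g ` K))"
  unfolding continuous_map_upper_lower_semicontinuous_lt
proof (intro conjI allI)
  fix c
  have "{K \<in> topspace mpcc_space. c < Sup (g ` K)} = {K \<in> mpcc. K \<inter> {v. c < g v} \<noteq> {}}"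
  proof -
    have "c < Sup (g ` K) \<longleftrightarrow> K \<inter> {v. c < g v} \<noteq> {}" if K: "K \<in> mpcc" for K
    proof -
      obtain v where "v \<in> K" "Sup (g ` K) = g v" "\<And>w. w \<in> K \<Longrightarrow> g w \<le> g v"
        by (rule Sup_image_compact_attained[OF g, of K]) (use K mpcc_iff in auto)
      then show ?thesis
        by (force intro: less_le_trans)
    qed
    then show ?thesis
      by auto
  qed
  then show "openin mpcc_space {K \<in> topspace mpcc_space. c < Sup (g ` K)}"
    using openin_mpcc_space_meets[OF open_Collect_less[OF continuous_on_const g]] by simp
  have "{K \<in> topspace mpcc_space. Sup (g ` K) < c} = {K \<in> mpcc. K \<subseteq> {v. g v < c}}"
  proof -
    have "Sup (g ` K) < c \<longleftrightarrow> K \<subseteq> {v. g v < c}" if K: "K \<in> mpcc" for K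
    proof -
      obtain v where "v \<in> K" "Sup (g ` K) = g v" "\<And>w. w \<in> K \<Longrightarrow> g w \<le> g v"
        by (rule Sup_image_compact_attained[OF g, of K]) (use K mpcc_iff in auto)
      then show ?thesis
        by (force intro: le_less_trans)
    qed
    then show ?thesis
      by auto
  qed
  then show "openin mpcc_space {K \<in> topspace mpcc_space. Sup (g ` K) < c}"
    using openin_mpcc_space_subset[OF open_Collect_less[OF g continuous_on_const]] by simp
qed

text \<open>As \<open>t\<close> runs through \<open>[-1,1]\<close>, the pair \<open>(min 0 t, min 0 (-t))\<close> runs through the pairs of
  coefficients in \<open>[-1,0]\<close> with maximum \<open>0\<close>. Bounding the coefficients from below preserves
  max-plus convexity and gives a compact parameter space; for vectors with values in \<open>[0,1]\<close>
  the result is the full max-plus segment.\<close>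

definition mp_point :: "('a \<Rightarrow> real) \<Rightarrow> ('a \<Rightarrow> real) \<Rightarrow> real \<Rightarrow> 'a \<Rightarrow> real" where
  "mp_point v w t = (\<lambda>i. max (min 0 t + v i) (min 0 (- t) + w i))"

definition mp_segment :: "('a \<Rightarrow> real) \<Rightarrow> ('a \<Rightarrow> real) \<Rightarrow> ('a \<Rightarrow> real) set" where
  "mp_segment v w = mp_point v w ` {-1..1}"

lemma mp_segment_commute: "mp_segment v w = mp_segment w v"
proof -
  have "mp_point w v t = mp_point v w (- t)" for t and v w :: "'a \<Rightarrow> real"
    by (simp add: mp_point_def max.commute)
  then have "mp_segment w v \<subseteq> mp_segment v w" for v w :: "'a \<Rightarrow> real"
    unfolding mp_segment_def by (intro image_subsetI) (metis atLeastAtMost_iff imageI minus_le_iff neg_le_iff_le)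
  then show ?thesis
    by blast
qed

lemma maxplus_convex_mp_segment: "maxplus_convex (mp_segment v w)"
  unfolding maxplus_convex_def
proof (intro ballI allI impI)
  fix p q \<alpha> \<beta>
  assume "p \<in> mp_segment v w" "q \<in> mp_segment v w" and \<alpha>\<beta>: "max \<alpha> \<beta> = (0::real)"
  then obtain t s where t: "-1 \<le> t" "t \<le> 1" "p = mp_point v w t" and s: "-1 \<le> s" "s \<le> 1" "q = mp_point v w s"
    by (auto simp: mp_segment_def)
  \<comment> \<open>\<open>A\<close> and \<open>B\<close> are the resulting coefficients of
    \<open>v\<close> and \<open>w\<close>. Both lie in [-1,0] and one of them is 0, so the parameter
    \<open>A - B\<close> recovers both.\<close>
  define A where "A = max (\<alpha> + min 0 t) (\<beta> + min 0 s)"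
  define B where "B = max (\<alpha> + min 0 (- t)) (\<beta> + min 0 (- s))"
  have "A \<le> 0" "B \<le> 0" "-1 \<le> A" "-1 \<le> B" "A = 0 \<or> B = 0"
    using t(1,2) s(1,2) \<alpha>\<beta> unfolding A_def B_def by linarith+
  then have "min 0 (A - B) = A" "min 0 (- (A - B)) = B" "A - B \<in> {-1..1}"
    by auto
  moreover have "max (\<alpha> + p i) (\<beta> + q i) = max (A + v i) (B + w i)" for i
    unfolding t s A_def B_def mp_point_def by (auto simp: max_def)
  ultimately have "(\<lambda>i. max (\<alpha> + p i) (\<beta> + q i)) = mp_point v w (A - B)" "A - B \<in> {-1..1}"
    unfolding mp_point_def by auto
  then show "(\<lambda>i. max (\<alpha> + p i) (\<beta> + q i)) \<in> mp_segment v w"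
    by (auto simp: mp_segment_def)
qed

lemma continuous_on_mp_point:
  fixes v w :: "'x::topological_space \<Rightarrow> 'a \<Rightarrow> real"
  assumes "continuous_on UNIV v" "continuous_on UNIV w"
  shows "continuous_on UNIV (\<lambda>p. mp_point (v (fst p)) (w (fst p)) (snd p))"
proof (rule continuous_on_coordinatewise_then_product)
  fix i
  have "continuous_on UNIV (\<lambda>p :: 'x \<times> real. v (fst p) i)" "continuous_on UNIV (\<lambda>p :: 'x \<times> real. w (fst p) i)"
    using continuous_on_compose2[OF continuous_on_product_then_coordinatewise[OF assms(1)]
        continuous_on_fst[OF continuous_on_id]]
      continuous_on_compose2[OF continuous_on_product_then_coordinatewise[OF assms(2)]
        continuous_on_fst[OF continuous_on_id]]
    by (simp_all del: split_paired_All)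
  then show "continuous_on UNIV (\<lambda>p. mp_point (v (fst p)) (w (fst p)) (snd p) i)"
    unfolding mp_point_def by (intro continuous_intros)
qed

lemma mp_segment_in_mpcc: "mp_segment v w \<in> mpcc"
proof -
  have "continuous_on UNIV (\<lambda>p::real \<times> real. mp_point v w (snd p))"
    by (rule continuous_on_mp_point) (rule continuous_on_const)+
  then have "continuous_on {-1..1} (\<lambda>t::real. mp_point v w (snd (0::real, t)))"
    by (rule continuous_on_compose2) (auto intro!: continuous_intros)
  then have "compact (mp_segment v w)"
    unfolding mp_segment_def by (intro compact_continuous_image) auto
  then show ?thesis
    using maxplus_convex_mp_segment[of v w] by (auto simp: mpcc_iff mp_segment_def)
qed

text \<open>Containment in an open set is an open condition by the tube lemma over the compact
  interval [-1,1]; meeting an open set is a union over \<open>t\<close> of open conditions.\<close>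

lemma continuous_map_mp_segment:
  fixes v w :: "'x::topological_space \<Rightarrow> 'a \<Rightarrow> real"
  assumes v: "continuous_on UNIV v" and w: "continuous_on UNIV w"
  shows "continuous_map euclidean mpcc_space (\<lambda>z. mp_segment (v z) (w z))"
proof -
  let ?s = "\<lambda>z. mp_segment (v z) (w z)"
  let ?P = "\<lambda>p. mp_point (v (fst p)) (w (fst p)) (snd p)"
  have P: "open (?P -` W)" if "open W" for W
    using continuous_on_mp_point[OF v w] that by (simp add: continuous_on_open_vimage)
  have sub: "open {z. ?s z \<subseteq> W}" if W: "open W" for W
  proof (subst open_subopen, intro ballI)
    fix z assume "z \<in> {z. ?s z \<subseteq> W}"
    then have "{z} \<times> {-1..1} \<subseteq> ?P -` W"
      by (auto simp: mp_segment_def)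
    from Elementary_Topology.tube_lemma[OF compact_Icc P[OF W] this]
    obtain Z where "z \<in> Z" "open Z" "Z \<times> {-1..1} \<subseteq> ?P -` W"
      by (elim exE conjE)
    then show "\<exists>T. open T \<and> z \<in> T \<and> T \<subseteq> {z. ?s z \<subseteq> W}"
      by (intro exI[of _ Z]) (auto simp: mp_segment_def)
  qed
  have meets: "open {z. ?s z \<inter> W \<noteq> {}}" if W: "open W" for W
  proof -
    have "{z. ?s z \<inter> W \<noteq> {}} = (\<Union>t\<in>{-1..1}. (\<lambda>z. (z, t)) -` (?P -` W))"
      by (auto simp: mp_segment_def)
    moreover have "open ((\<lambda>z. (z, t)) -` (?P -` W))" for t
      by (intro open_vimage P W continuous_intros)
    ultimately show ?thesis
      by auto
  qed
  have top: "?s ` topspace euclidean \<subseteq> topspace mpcc_space"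
    by (auto simp: mp_segment_in_mpcc)
  show ?thesis
    unfolding mpcc_space_def vietoris_on_def
  proof (rule continuous_on_generated_topo)
    fix O' :: "('a \<Rightarrow> real) set set"
    assume "O' \<in> {{K \<in> mpcc. K \<subseteq> U} |U. openin (powertop_real UNIV) U} \<union>
        {{K \<in> mpcc. K \<inter> U \<noteq> {}} |U. openin (powertop_real UNIV) U}"
    then obtain W where "open W" "O' = {K \<in> mpcc. K \<subseteq> W} \<or> O' = {K \<in> mpcc. K \<inter> W \<noteq> {}}"
      by (auto simp: euclidean_product_topology)
    then show "openin euclidean (?s -` O' \<inter> topspace euclidean)"
      using sub[of W] meets[of W] by (auto simp: vimage_def mp_segment_in_mpcc)
  next
    show "?s ` topspace euclidean \<subseteq> \<Union> ({{K \<in> mpcc. K \<subseteq> U} |U. openin (powertop_real UNIV) U} \<union>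
        {{K \<in> mpcc. K \<inter> U \<noteq> {}} |U. openin (powertop_real UNIV) U})"
      using top unfolding mpcc_space_def vietoris_on_def topology_generated_by_topspace .
  qed
qed


section \<open>The obstruction\<close>

lemma mpcc_space_not_retract_of_fopen_sub:
  assumes card: "(cardSuc natLeq, card_of (UNIV :: 'a set)) \<in> ordLess"
  shows "\<not> retract_of_fopen_sub (powertop_real (UNIV :: 'b set)) (mpcc_space :: ('a \<Rightarrow> real) set topology)"
proof
  assume "retract_of_fopen_sub (powertop_real (UNIV :: 'b set)) (mpcc_space :: ('a \<Rightarrow> real) set topology)"
  then obtain U Y :: "('b \<Rightarrow> real) set" where fo: "functionally_open euclidean U"
    and ret: "Y retract_of_space (top_of_set U)"
    and hom: "(mpcc_space :: ('a \<Rightarrow> real) set topology) homeomorphic_space top_of_set Y"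
    by (auto simp: retract_of_fopen_sub_def euclidean_product_topology)
  obtain f where f: "continuous_on UNIV f" and U_eq: "U = {u. f u > (0::real)}"
    using fo by (force simp: functionally_open_def continuous_map_in_subtopology)
  have openU: "open U"
    unfolding U_eq by (intro open_Collect_less f continuous_on_const)
  obtain r where "Y \<subseteq> U" and r: "continuous_map (top_of_set U) (top_of_set Y) r" "\<forall>y\<in>Y. r y = y"
    using ret by (auto simp: retract_of_space_def subtopology_subtopology inf_absorb2)
  obtain h h' where h: "continuous_map mpcc_space (top_of_set Y) h"
    and h': "continuous_map (top_of_set Y) (mpcc_space :: ('a \<Rightarrow> real) set topology) h'"
    and h'h: "\<forall>K\<in>mpcc. h' (h K) = K"
    using hom by (auto simp: homeomorphic_space_def homeomorphic_maps_def)
  define R where "R = h' \<circ> r"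
  have R: "continuous_map (top_of_set U) mpcc_space R"
    unfolding R_def by (rule continuous_map_compose[OF r(1) h'])
  have hY: "h K \<in> Y" if "K \<in> mpcc" for K
    using h that by (auto simp: continuous_map_def)
  have hU: "h K \<in> U" if "K \<in> mpcc" for K
    using hY[OF that] \<open>Y \<subseteq> U\<close> by auto
  have Rh: "R (h K) = K" if "K \<in> mpcc" for K
    using hY[OF that] r(2) h'h that by (simp add: R_def)
  have RU: "R u \<in> mpcc" if "u \<in> U" for u
    using R that by (auto simp: continuous_map_def)
  have hseg: "continuous_on UNIV (\<lambda>z. h (mp_segment (v z) (w z)) \<beta>)"
    if "continuous_on UNIV v" "continuous_on UNIV w" for v w :: "'z::topological_space \<Rightarrow> 'a \<Rightarrow> real" and \<beta>
  proof -
    have "continuous_map mpcc_space euclidean h"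
      using h continuous_map_into_fulltopology by blast
    then have "continuous_map euclidean euclidean (h \<circ> (\<lambda>z. mp_segment (v z) (w z)))"
      by (rule continuous_map_compose[OF continuous_map_mp_segment[OF that]])
    then have "continuous_on UNIV (\<lambda>z. h (mp_segment (v z) (w z)))"
      by (simp add: o_def)
    then show ?thesis
      by (rule continuous_on_product_then_coordinatewise)
  qed
  have supp: "\<exists>B. countable B \<and> determined_by B U (\<lambda>u. Sup (g ` R u))"
    if "continuous_on UNIV g" for g :: "('a \<Rightarrow> real) \<Rightarrow> real"
  proof -
    have "continuous_map (top_of_set U) euclideanreal ((\<lambda>K. Sup (g ` K)) \<circ> R)"
      by (rule continuous_map_compose[OF R continuous_map_Sup_mpcc_space[OF that]])
    then have "continuous_on U (\<lambda>u. Sup (g ` R u))"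
      by (simp add: o_def)
    then show ?thesis
      using cozero_countably_determined[OF f] by (simp add: U_eq)
  qed

  fix x :: 'a
  \<comment> \<open>\<open>Sup (g1 a ` K) \<ge> 0\<close> says that \<open>K\<close> has a point with \<open>x\<close>- and \<open>a\<close>-coordinate at most \<open>0\<close>;
    \<open>Sup (g2 a n ` K) \<le> 0\<close> that the points of \<open>K\<close> with small \<open>x\<close>-coordinate have \<open>a\<close>-coordinate at least \<open>1\<close>.\<close>
  define g1 where "g1 a v = - max (v x) (v a)" for a and v :: "'a \<Rightarrow> real"
  define g2 where "g2 a n v = min (inverse (real (Suc n)) - v x) (1 - v a)" for a n and v :: "'a \<Rightarrow> real"
  have g1: "continuous_on UNIV (g1 a)" for a
    unfolding g1_def by (intro continuous_intros continuous_on_product_coordinates)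
  have g2: "continuous_on UNIV (g2 a n)" for a n
    unfolding g2_def by (intro continuous_intros continuous_on_product_coordinates)
  obtain B1 where B1: "\<And>a. countable (B1 a)" "\<And>a. determined_by (B1 a) U (\<lambda>u. Sup (g1 a ` R u))"
    using supp[OF g1] by metis
  obtain B2 where B2: "\<And>a n. countable (B2 a n)" "\<And>a n. determined_by (B2 a n) U (\<lambda>u. Sup (g2 a n ` R u))"
    using supp[OF g2] by metis
  define B where "B a = B1 a \<union> (\<Union>n. B2 a n)" for a
  have countB: "countable (B a)" for a
    unfolding B_def using B1(1) B2(1) by auto
  \<comment> \<open>Both end points are coded as one point of the power over
    \<open>'a \<times> bool\<close>, which is the cozero set of the constant 1. So each coordinate
    of \<open>h\<close> on segments depends on countably many end-point coordinates.\<close>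
  have "\<exists>E. countable E \<and> determined_by E UNIV
      (\<lambda>z :: 'a \<times> bool \<Rightarrow> real. h (mp_segment (\<lambda>i. z (i, True)) (\<lambda>i. z (i, False))) \<beta>)" for \<beta>
  proof -
    have "continuous_on UNIV
      (\<lambda>z :: 'a \<times> bool \<Rightarrow> real. h (mp_segment (\<lambda>i. z (i, True)) (\<lambda>i. z (i, False))) \<beta>)"
      by (intro hseg continuous_on_coordinatewise_then_product continuous_on_product_coordinates)
    then show ?thesis
      using cozero_countably_determined[of "\<lambda>_. 1"] by simp
  qed
  then have "\<forall>\<beta>. \<exists>E. countable E \<and> determined_by E UNIV
      (\<lambda>z :: 'a \<times> bool \<Rightarrow> real. h (mp_segment (\<lambda>i. z (i, True)) (\<lambda>i. z (i, False))) \<beta>)"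
    by (rule allI)
  from choice[OF this] obtain E where E: "\<And>\<beta>. countable (E \<beta>)" "\<And>\<beta>. determined_by (E \<beta>) UNIV
      (\<lambda>z :: 'a \<times> bool \<Rightarrow> real. h (mp_segment (\<lambda>i. z (i, True)) (\<lambda>i. z (i, False))) \<beta>)"
    by auto
  \<comment> \<open>\<open>A a\<close> collects the indices visible to the coordinates of
    \<open>h\<close> that matter for \<open>a\<close>; inserting \<open>x\<close> and
    \<open>a\<close> keeps the free pair distinct from \<open>x\<close> and from each other.\<close>
  define A where "A a = insert x (insert a (\<Union>\<beta>\<in>B a. fst ` E \<beta>))" for a
  have "countable (A a)" for a
    unfolding A_def using countB E(1) by auto
  from free_pair_countable_set_mapping[OF card this]
  obtain a b where ab: "b \<notin> A a" "a \<notin> A b" .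
  then have neq: "a \<noteq> b" "b \<noteq> a" "a \<noteq> x" "b \<noteq> x"
    by (auto simp: A_def)

  define e where "e i = (if i = a \<or> i = b then 1 else 0 :: real)" for i
  define s where "s \<epsilon> i = (if i = x then \<epsilon> else 0 :: real)" for \<epsilon> i
  define K1 where "K1 \<epsilon> = mp_segment (\<lambda>_. 0) (\<lambda>i. e i + s \<epsilon> i)" for \<epsilon>
  define K2 where "K2 \<epsilon> = mp_segment e (s \<epsilon>)" for \<epsilon>
  define u where "u \<epsilon> = (\<lambda>\<beta>. if \<beta> \<in> B a then h (K1 \<epsilon>) \<beta> else h (K2 \<epsilon>) \<beta>)" for \<epsilon>
  have K_mpcc: "K1 \<epsilon> \<in> mpcc" "K2 \<epsilon> \<in> mpcc" for \<epsilon>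
    by (simp_all add: K1_def K2_def mp_segment_in_mpcc)
  have s: "continuous_on UNIV s"
  proof (rule continuous_on_coordinatewise_then_product)
    show "continuous_on UNIV (\<lambda>\<epsilon>. s \<epsilon> i)" for i
      unfolding s_def by (cases "i = x") (auto intro: continuous_intros)
  qed
  have es: "continuous_on UNIV (\<lambda>\<epsilon> i. e i + s \<epsilon> i)"
    by (intro continuous_on_coordinatewise_then_product continuous_intros
        continuous_on_product_then_coordinatewise[OF s])
  have u: "continuous_on UNIV u"
  proof (rule continuous_on_coordinatewise_then_product)
    fix \<beta>
    show "continuous_on UNIV (\<lambda>\<epsilon>. u \<epsilon> \<beta>)"
      using hseg[OF continuous_on_const es, of "\<lambda>_. 0" \<beta>] hseg[OF continuous_on_const s, of e \<beta>]
      by (cases "\<beta> \<in> B a") (simp_all add: u_def K1_def K2_def)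
  qed
  have s0: "s 0 = (\<lambda>_. 0)"
    by (auto simp: s_def)
  \<comment> \<open>Both are the segment between 0 and \<open>e\<close>, so at parameter 0 the
    gluing has no effect.\<close>
  then have "K2 0 = K1 0"
    unfolding K1_def K2_def by (simp add: mp_segment_commute)
  then have u0: "u 0 = h (K1 0)"
    by (auto simp: u_def)
  define W where "W = {v :: 'a \<Rightarrow> real. v b - v a < 1}"
  have W: "open W"
    unfolding W_def by (intro open_Collect_less continuous_intros continuous_on_product_coordinates)
  have "openin (top_of_set U) {w \<in> topspace (top_of_set U). R w \<in> {K \<in> mpcc. K \<subseteq> W}}"
    by (rule openin_continuous_map_preimage[OF R openin_mpcc_space_subset[OF W]])
  then have "open {w \<in> U. R w \<in> {K \<in> mpcc. K \<subseteq> W}}"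
    using openU by (simp add: openin_open_eq)
  then have "open (u -` {w \<in> U. R w \<in> {K \<in> mpcc. K \<subseteq> W}})"
    using u by (rule open_vimage)
  moreover have "K1 0 \<subseteq> W"
    using neq by (auto simp: K1_def W_def s0 mp_segment_def mp_point_def e_def)
  then have "0 \<in> u -` {w \<in> U. R w \<in> {K \<in> mpcc. K \<subseteq> W}}"
    using K_mpcc(1)[of 0] hU Rh by (simp add: u0)
  ultimately obtain d where "d > 0" and d: "ball 0 d \<subseteq> u -` {w \<in> U. R w \<in> {K \<in> mpcc. K \<subseteq> W}}"
    unfolding open_contains_ball by (metis (lifting))
  obtain n where "inverse (real (Suc n)) < d"
    using reals_Archimedean[OF \<open>d > 0\<close>] by blast
  \<comment> \<open>This form matters: \<open>B b\<close> serves the functions \<open>g2 b n\<close>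
    for all \<open>n\<close> at once and stays countable, so \<open>n\<close> may be chosen after
    \<open>a\<close> and \<open>b\<close>.\<close>
  define \<epsilon> where "\<epsilon> = inverse (real (Suc n))"
  have \<epsilon>: "0 < \<epsilon>" "\<epsilon> \<le> 1" "\<epsilon> \<in> ball 0 d"
    using \<open>inverse (real (Suc n)) < d\<close> by (auto simp: \<epsilon>_def inverse_le_1_iff)
  have uU: "u \<epsilon> \<in> U" and RW: "R (u \<epsilon>) \<subseteq> W"
    using subsetD[OF d \<epsilon>(3)] by auto

  have agree: "h (K1 \<epsilon>) \<beta> = h (K2 \<epsilon>) \<beta>" if "\<beta> \<in> B a" "\<beta> \<in> B b" for \<beta>
  proof -
    define z1 where "z1 p = (if snd p then 0 else e (fst p) + s \<epsilon> (fst p))" for p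
    define z2 where "z2 p = (if snd p then e (fst p) else s \<epsilon> (fst p))" for p
    have "a \<notin> fst ` E \<beta>" "b \<notin> fst ` E \<beta>"
      using ab that by (auto simp: A_def)
    \<comment> \<open>The two codes differ only at indices with first component \<open>a\<close> or
      \<open>b\<close>.\<close>
    then have "\<forall>p\<in>E \<beta>. z1 p = z2 p"
      by (force simp: z1_def z2_def e_def)
    then have "h (mp_segment (\<lambda>i. z1 (i, True)) (\<lambda>i. z1 (i, False))) \<beta> =
        h (mp_segment (\<lambda>i. z2 (i, True)) (\<lambda>i. z2 (i, False))) \<beta>"
      using E(2)[of \<beta>] unfolding determined_by_def by blast
    then show ?thesis
      by (simp add: z1_def z2_def K1_def K2_def)
  qed
  have "\<forall>\<beta>\<in>B1 a. u \<epsilon> \<beta> = h (K1 \<epsilon>) \<beta>"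
    by (auto simp: u_def B_def)
  then have "Sup (g1 a ` R (u \<epsilon>)) = Sup (g1 a ` R (h (K1 \<epsilon>)))"
    using B1(2)[of a] uU hU[OF K_mpcc(1)] unfolding determined_by_def by blast
  then have Sup1: "Sup (g1 a ` R (u \<epsilon>)) = Sup (g1 a ` K1 \<epsilon>)"
    by (simp add: Rh K_mpcc)
  \<comment> \<open>Outside \<open>B a\<close> this is the definition of \<open>u\<close>; inside
    \<open>B a\<close> it is \<open>agree\<close>.\<close>
  have "\<forall>\<beta>\<in>B2 b n. u \<epsilon> \<beta> = h (K2 \<epsilon>) \<beta>"
    using agree by (auto simp: u_def B_def)
  then have "Sup (g2 b n ` R (u \<epsilon>)) = Sup (g2 b n ` R (h (K2 \<epsilon>)))"
    using B2(2)[of b n] uU hU[OF K_mpcc(2)] unfolding determined_by_def by blast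
  then have Sup2: "Sup (g2 b n ` R (u \<epsilon>)) = Sup (g2 b n ` K2 \<epsilon>)"
    by (simp add: Rh K_mpcc)

  have attained: "\<exists>v\<in>K. Sup (g ` K) = g v \<and> (\<forall>w\<in>K. g w \<le> g v)"
    if "continuous_on UNIV g" "K \<in> mpcc" for g :: "('a \<Rightarrow> real) \<Rightarrow> real" and K
    using Sup_image_compact_attained[OF that(1), of K] that(2) mpcc_iff by metis
  obtain v where v: "v \<in> R (u \<epsilon>)" "Sup (g1 a ` R (u \<epsilon>)) = g1 a v"
    using attained[OF g1[of a] RU[OF uU]] by auto
  \<comment> \<open>Parameter 1 lowers the second end point by 1, so since \<epsilon> \<le> 1 the
    coordinates at \<open>x\<close> and \<open>a\<close> are 0.\<close>
  have "mp_point (\<lambda>_. 0) (\<lambda>i. e i + s \<epsilon> i) 1 \<in> K1 \<epsilon>"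
    by (simp add: K1_def mp_segment_def)
  moreover have "g1 a (mp_point (\<lambda>_. 0) (\<lambda>i. e i + s \<epsilon> i) 1) = 0"
    using neq \<epsilon> by (simp add: g1_def mp_point_def e_def s_def)
  ultimately have "0 \<le> Sup (g1 a ` K1 \<epsilon>)"
    using attained[OF g1[of a] K_mpcc(1)[of \<epsilon>]] by force
  then have vxa: "v x \<le> 0" "v a \<le> 0"
    using v Sup1 by (auto simp: g1_def)
  have g2_eq: "g2 b n w = min (\<epsilon> - w x) (1 - w b)" for w
    by (simp only: g2_def \<epsilon>_def)
  have "g2 b n w \<le> 0" if w: "w \<in> K2 \<epsilon>" for w
  proof -
    obtain t where "w = mp_point e (s \<epsilon>) t"
      using w by (auto simp: K2_def mp_segment_def)
    \<comment> \<open>For \<open>t \<ge> 0\<close> the \<open>b\<close>-coordinate is 1; for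
      \<open>t < 0\<close> the \<open>x\<close>-coordinate is \<epsilon>.\<close>
    then show ?thesis
      using neq \<epsilon> by (auto simp: g2_eq mp_point_def e_def s_def max_def min_def)
  qed
  then have "Sup (g2 b n ` K2 \<epsilon>) \<le> 0"
    using attained[OF g2[of b n] K_mpcc(2)[of \<epsilon>]] by force
  then have "g2 b n v \<le> 0"
    using attained[OF g2[of b n] RU[OF uU]] v(1) Sup2 by force
  \<comment> \<open>Since \<open>v x \<le> 0 < \<epsilon>\<close>, the first argument of the minimum
    is positive, so the second is at most 0.\<close>
  then have "v b \<ge> 1"
    using vxa(1) \<epsilon>(1) by (auto simp: g2_eq)
  moreover have "v b - v a < 1"
    using v(1) RW by (auto simp: W_def)
  ultimately show False
    using vxa(2) by simp
qed

theorem theorem4p6: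
  assumes "(cardSuc natLeq, card_of (UNIV :: 'a set)) \<in> ordLess"
  shows "\<not> retract_of_fopen_sub (powertop_real (UNIV :: 'b set)) (mpcc_space :: ('a \<Rightarrow> real) set topology)
         \<and> \<not> (mpcc_space :: ('a \<Rightarrow> real) set topology) homeomorphic_space powertop_real (UNIV :: 'a set)"
proof
  show "\<not> retract_of_fopen_sub (powertop_real (UNIV :: 'b set)) (mpcc_space :: ('a \<Rightarrow> real) set topology)"
    by (rule mpcc_space_not_retract_of_fopen_sub[OF assms])
  show "\<not> (mpcc_space :: ('a \<Rightarrow> real) set topology) homeomorphic_space powertop_real (UNIV :: 'a set)"
  proof
    let ?P = "powertop_real (UNIV :: 'a set)"
    assume hom: "(mpcc_space :: ('a \<Rightarrow> real) set topology) homeomorphic_space ?P"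
    have "functionally_open ?P (topspace ?P)"
      unfolding functionally_open_def by (rule exI[of _ "\<lambda>_. 1"]) auto
    moreover have "topspace ?P retract_of_space subtopology ?P (topspace ?P)"
      by (auto simp: retract_of_space_def intro!: exI[of _ "\<lambda>x. x"])
    ultimately have "retract_of_fopen_sub ?P (mpcc_space :: ('a \<Rightarrow> real) set topology)"
      unfolding retract_of_fopen_sub_def using hom
      by (intro exI[of _ "topspace ?P"] conjI) simp_all
    then show False
      using mpcc_space_not_retract_of_fopen_sub[OF assms] by blast
  qed
qed

end
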